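(* For $n\ge1$, $|\mathbf{I}_n(010,011)|=\sum_{k=0}^{n-1}(n-k)^k$.
   Context: An inversion sequence of length $n$ is an integer sequence $e=(e_1,\dots,e_n)$ with $0\le e_i\le i-1$ for all $1\le i\le n$. A word $w_1\cdots w_n$ avoids a pattern $P=p_1\cdots p_k$ if there are no $i_1<\cdots<i_k$ such that $w_{i_1}\cdots w_{i_k}$ is order isomorphic to $P$ (equal letters of $P$ corresponding to equal entries). $\mathbf{I}_n(P_1,P_2)$ denotes the set of inversion sequences of length $n$ avoiding both $P_1$ and $P_2$. *)

theory Defs
  imports Main "HOL-Library.Sublist"
begin

text \<open>The letter \<open>e\<^sub>i\<close> (\<open>1 \<le> i \<le> n\<close>) of a word is the list entry \<open>e ! (i - 1)\<close>. Since the entries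
  are nonnegative integers, words are lists of natural numbers.\<close>

definition inversion_sequence :: "nat \<Rightarrow> nat list \<Rightarrow> bool" where
  "inversion_sequence n e \<longleftrightarrow> length e = n \<and> (\<forall>i\<in>{1..n}. e ! (i - 1) \<le> i - 1)"

definition order_isomorphic :: "nat list \<Rightarrow> nat list \<Rightarrow> bool" where
  "order_isomorphic u v \<longleftrightarrow> length u = length v \<and>
     (\<forall>i<length u. \<forall>j<length u.
        (u ! i < u ! j \<longleftrightarrow> v ! i < v ! j) \<and> (u ! i = u ! j \<longleftrightarrow> v ! i = v ! j))"

text \<open>The lists \<open>s\<close> with \<open>subseq s w\<close> are the subwords at (not necessarily adjacent) positions
  \<open>i\<^sub>1 < \<dots> < i\<^sub>k\<close> of \<open>w\<close>.\<close>

definition avoids :: "nat list \<Rightarrow> nat list \<Rightarrow> bool" where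
  "avoids w p \<longleftrightarrow> \<not> (\<exists>s. subseq s w \<and> order_isomorphic s p)"

definition avoiding_inversion_sequences :: "nat \<Rightarrow> nat list \<Rightarrow> nat list \<Rightarrow> nat list set" where
  "avoiding_inversion_sequences n p q =
     {e. inversion_sequence n e \<and> avoids e p \<and> avoids e q}"

end

theory Submission
  imports Defs
begin

text \<open>An inversion sequence starts with \<open>0\<close>. Let \<open>m \<ge> 1\<close> be the length of its initial run of zeros,
  and suppose that it avoids 010 and 011. Behind the first positive letter \<open>b\<close> there is no further
  \<open>0\<close>, since \<open>0 b 0\<close> would be an occurrence of 010; and no positive letter \<open>b\<close> occurs twice, since
  together with the leading \<open>0\<close> it would form \<open>0 b b\<close>, an occurrence of 011. So the word is \<open>0\<^sup>m s\<close>
  with distinct positive letters in \<open>s\<close>. Conversely every such word avoids both patterns: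
  an occurrence of 011 repeats a positive letter, an occurrence of 010 repeats a letter around a
  larger one, and in \<open>0\<^sup>m s\<close> the only letter that can repeat is \<open>0\<close>, all of whose occurrences come
  first (\<open>avoiding_inversion_sequences_010_011_iff\<close>).

  It remains to count the tails \<open>s\<close>. The letter at position \<open>m + j\<close> of the word (\<open>j \<ge> 1\<close>) is chosen
  from \<open>{1..m + j - 1}\<close>, and the \<open>j - 1\<close> letters of \<open>s\<close> already used lie in that set. This
  leaves \<open>m\<close> choices whatever \<open>j\<close> is, hence \<open>m\<^sup>n\<^sup>-\<^sup>m\<close> tails (\<open>card_distinct_tails\<close>). Summing over \<open>m\<close> and
  putting \<open>k = n - m\<close> gives the formula.\<close>

section \<open>Occurrences of the two patterns\<close>

lemma order_isomorphic_010_iff: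
  "order_isomorphic s [0, 1, 0] \<longleftrightarrow> (\<exists>a b. s = [a, b, a] \<and> a < b)"
proof
  assume iso: "order_isomorphic s [0, 1, 0]"
  then have "length s = 3"
    by (simp add: order_isomorphic_def)
  then obtain a b c where s: "s = [a, b, c]"
    by (auto simp: numeral_3_eq_3 length_Suc_conv)
  have lt: "s ! i < s ! j \<longleftrightarrow> [0, 1, 0] ! i < ([0, 1, 0] :: nat list) ! j"
    and eq: "s ! i = s ! j \<longleftrightarrow> [0, 1, 0] ! i = ([0, 1, 0] :: nat list) ! j"
    if "i < 3" and "j < 3" for i j
    using iso that \<open>length s = 3\<close> by (simp_all add: order_isomorphic_def)
  show "\<exists>a b. s = [a, b, a] \<and> a < b"
    using lt[of 0 1] eq[of 0 2] by (simp add: s)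
next
  assume "\<exists>a b. s = [a, b, a] \<and> a < b"
  then show "order_isomorphic s [0, 1, 0]"
    by (auto simp: order_isomorphic_def less_Suc_eq)
qed

lemma order_isomorphic_011_iff:
  "order_isomorphic s [0, 1, 1] \<longleftrightarrow> (\<exists>a b. s = [a, b, b] \<and> a < b)"
proof
  assume iso: "order_isomorphic s [0, 1, 1]"
  then have "length s = 3"
    by (simp add: order_isomorphic_def)
  then obtain a b c where s: "s = [a, b, c]"
    by (auto simp: numeral_3_eq_3 length_Suc_conv)
  have lt: "s ! i < s ! j \<longleftrightarrow> [0, 1, 1] ! i < ([0, 1, 1] :: nat list) ! j"
    and eq: "s ! i = s ! j \<longleftrightarrow> [0, 1, 1] ! i = ([0, 1, 1] :: nat list) ! j"
    if "i < 3" and "j < 3" for i j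
    using iso that \<open>length s = 3\<close> by (simp_all add: order_isomorphic_def)
  show "\<exists>a b. s = [a, b, b] \<and> a < b"
    using lt[of 0 1] eq[of 1 2] by (simp add: s)
next
  assume "\<exists>a b. s = [a, b, b] \<and> a < b"
  then show "order_isomorphic s [0, 1, 1]"
    by (auto simp: order_isomorphic_def less_Suc_eq)
qed

lemma avoids_010_iff: "avoids w [0, 1, 0] \<longleftrightarrow> (\<forall>a b. subseq [a, b, a] w \<longrightarrow> \<not> a < b)"
  unfolding avoids_def order_isomorphic_010_iff by blast

lemma avoids_011_iff: "avoids w [0, 1, 1] \<longleftrightarrow> (\<forall>a b. subseq [a, b, b] w \<longrightarrow> \<not> a < b)"
  unfolding avoids_def order_isomorphic_011_iff by blast

section \<open>Shape of the avoiding sequences\<close>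

text \<open>The index \<open>i\<close> of \<open>s\<close> is the index \<open>m + i\<close> of the whole word \<open>0\<^sup>m s\<close>; this is where the upper
  bound comes from.\<close>

definition distinct_tails :: "nat \<Rightarrow> nat \<Rightarrow> nat list set" where
  "distinct_tails m k =
     {s. length s = k \<and> distinct s \<and> 0 \<notin> set s \<and> (\<forall>i<k. s ! i \<le> m + i)}"

lemma inversion_sequence_iff:
  "inversion_sequence n e \<longleftrightarrow> length e = n \<and> (\<forall>i<n. e ! i \<le> i)"
proof -
  have "{1..n} = Suc ` {..<n}"
    by (simp add: image_Suc_lessThan)
  then have "(\<forall>i\<in>{1..n}. e ! (i - 1) \<le> i - 1) \<longleftrightarrow> (\<forall>i<n. e ! i \<le> i)"
    by auto
  then show ?thesis
    by (simp add: inversion_sequence_def)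
qed

lemma inversion_sequence_zeros_append_iff:
  "inversion_sequence n (replicate m 0 @ s) \<longleftrightarrow>
     m + length s = n \<and> (\<forall>i<length s. s ! i \<le> m + i)"
proof -
  have "(\<forall>i<m + length s. (replicate m 0 @ s) ! i \<le> i) \<longleftrightarrow> (\<forall>i<length s. s ! i \<le> m + i)"
    (is "?L \<longleftrightarrow> ?R")
  proof
    assume L: ?L
    show ?R
    proof (intro allI impI)
      fix i assume "i < length s"
      with L[rule_format, of "m + i"] show "s ! i \<le> m + i"
        by (simp add: nth_append)
    qed
  next
    assume R: ?R
    show ?L
    proof (intro allI impI)
      fix i assume "i < m + length s"
      with R[rule_format, of "i - m"] show "(replicate m 0 @ s) ! i \<le> i"
        by (cases "i < m") (auto simp: nth_append)
    qed
  qed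
  then show ?thesis
    by (auto simp: inversion_sequence_iff)
qed

lemma set_subseq_subset: "subseq s w \<Longrightarrow> set s \<subseteq> set w"
  by (metis subseq_conv_nths set_nths_subset)

lemma subseq_distinct: "subseq s w \<Longrightarrow> distinct w \<Longrightarrow> distinct s"
  by (metis subseq_conv_nths distinct_nthsI)

text \<open>Deleting the zeros from the word leaves the distinct letters of \<open>s\<close>, so no positive letter
  repeats; this excludes 011, and 010 unless its smaller letter is \<open>0\<close>. In an occurrence \<open>0 b 0\<close>, the last \<open>0\<close> would
  have to lie in the initial run, and then \<open>b\<close> would too.\<close>

lemma zeros_append_avoids:
  assumes "distinct s" and "0 \<notin> set s"
  shows "avoids (replicate m 0 @ s) [0, 1, 0]" and "avoids (replicate m 0 @ s) [0, 1, 1]"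
proof -
  have nonzeros: "filter (\<lambda>x. x \<noteq> 0) (replicate m 0 @ s) = s"
    using assms(2) by (simp add: filter_id_conv) (metis gr0I)
  have distinct_nonzeros: "distinct (filter (\<lambda>x. x \<noteq> 0) t)"
    if "subseq t (replicate m 0 @ s)" for t
    using subseq_filter[OF that, of "\<lambda>x. x \<noteq> 0"] subseq_distinct assms(1)
    unfolding nonzeros by blast
  show "avoids (replicate m 0 @ s) [0, 1, 1]"
    unfolding avoids_011_iff
  proof (intro allI impI notI)
    fix a b assume "subseq [a, b, b] (replicate m 0 @ s)" and "a < b"
    with distinct_nonzeros[of "[a, b, b]"] show False
      by (auto split: if_splits)
  qed
  show "avoids (replicate m 0 @ s) [0, 1, 0]"
    unfolding avoids_010_iff
  proof (intro allI impI notI)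
    fix a b assume sub: "subseq [a, b, a] (replicate m 0 @ s)" and "a < b"
    with distinct_nonzeros[of "[a, b, a]"] have "a = 0"
      by (auto split: if_splits)
    obtain p q where pq: "[a, b, a] = p @ q" "subseq p (replicate m 0)" "subseq q s"
      using sub by (auto elim: subseq_appendE)
    have "q = []"
    proof (rule ccontr)
      assume "q \<noteq> []"
      then have "a \<in> set q"
        using pq(1) by (metis last_appendR last_in_set last.simps list.distinct(1))
      then show False
        using \<open>a = 0\<close> set_subseq_subset[OF pq(3)] assms(2) by blast
    qed
    then have "b \<in> set p"
      using pq(1) by (metis append_Nil2 list.set_intros)
    then have "b = 0"
      using set_subseq_subset[OF pq(2)] by (auto split: if_splits)
    with \<open>a < b\<close> show False by simp
  qed
qed

text \<open>The first letter \<open>0\<close> extends any two letters of the tail to a subword of length three: a tail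
  \<open>y \<dots> 0\<close> yields 010 and a tail \<open>\<dots> y \<dots> y\<close> yields 011.\<close>

lemma avoids_imp_zeros_append:
  assumes "w \<noteq> []" and "hd w = 0" and "avoids w [0, 1, 0]" and "avoids w [0, 1, 1]"
  shows "\<exists>m s. m \<ge> 1 \<and> w = replicate m 0 @ s \<and> distinct s \<and> 0 \<notin> set s"
proof -
  define s where "s = dropWhile (\<lambda>x. x = 0) w"
  define m where "m = length (takeWhile (\<lambda>x. x = 0) w)"
  have "takeWhile (\<lambda>x. x = 0) w = replicate m 0"
    unfolding m_def by (rule replicate_eqI) (auto dest: set_takeWhileD)
  then have w: "w = replicate m 0 @ s"
    unfolding s_def by (metis takeWhile_dropWhile_id)
  have m: "m \<ge> 1"
    using assms(1,2) by (cases w) (auto simp: m_def)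
  have subseq_w: "subseq (0 # t) w" if "subseq t s" for t
  proof -
    have "subseq ([0] @ t) (replicate m 0 @ s)"
      using m that by (intro list_emb_append_mono) (auto simp: subseq_singleton_left)
    then show ?thesis
      by (simp add: w)
  qed
  have no_zero: "0 \<notin> set s"
  proof
    assume zero: "0 \<in> set s"
    then obtain y t where s: "s = y # t"
      by (cases s) auto
    have "y \<noteq> 0"
      using hd_dropWhile[of "\<lambda>x. x = 0" w] s unfolding s_def by (metis list.distinct(1) list.sel(1))
    moreover have "subseq [y, 0] s"
      using zero \<open>y \<noteq> 0\<close> by (simp add: s subseq_singleton_left)
    ultimately show False
      using subseq_w assms(3) unfolding avoids_010_iff by blast
  qed
  have "distinct s"
  proof (rule ccontr)
    assume "\<not> distinct s"
    then obtain xs ys zs y where s: "s = xs @ [y] @ ys @ [y] @ zs"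
      using not_distinct_decomp by blast
    have "subseq [y, y] s"
      by (simp add: s list_emb_append2)
    moreover have "y \<noteq> 0"
      using no_zero by (auto simp: s)
    ultimately show False
      using subseq_w assms(4) unfolding avoids_011_iff by blast
  qed
  with m w no_zero show ?thesis
    by blast
qed

lemma avoiding_inversion_sequences_010_011_iff:
  assumes "n \<ge> 1"
  shows "e \<in> avoiding_inversion_sequences n [0, 1, 0] [0, 1, 1] \<longleftrightarrow>
           (\<exists>m\<in>{1..n}. \<exists>s\<in>distinct_tails m (n - m). e = replicate m 0 @ s)"
    (is "?L \<longleftrightarrow> ?R")
proof
  assume ?L
  then have inv: "inversion_sequence n e" and av: "avoids e [0, 1, 0]" "avoids e [0, 1, 1]"
    by (simp_all add: avoiding_inversion_sequences_def)
  have "e \<noteq> []" "hd e = 0"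
    using inv assms by (cases e; force simp: inversion_sequence_iff)+
  then obtain m s where ms: "m \<ge> 1" "e = replicate m 0 @ s" "distinct s" "0 \<notin> set s"
    using avoids_imp_zeros_append av by blast
  then have "m + length s = n" "\<forall>i<length s. s ! i \<le> m + i"
    using inv by (simp_all add: inversion_sequence_zeros_append_iff)
  with ms have "m \<in> {1..n}" "s \<in> distinct_tails m (n - m)"
    by (auto simp: distinct_tails_def)
  with ms(2) show ?R by blast
next
  assume ?R
  then show ?L
    using zeros_append_avoids
    by (auto simp: avoiding_inversion_sequences_def distinct_tails_def
        inversion_sequence_zeros_append_iff simp del: One_nat_def)
qed

section \<open>Counting\<close>

lemma distinct_tails_Suc:
  "distinct_tails m (Suc k) =
     (\<lambda>(s, x). s @ [x]) ` (SIGMA s:distinct_tails m k. {1..m + k} - set s)" (is "?A = ?B")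
proof
  show "?A \<subseteq> ?B"
  proof
    fix t assume t: "t \<in> ?A"
    then obtain s x where tx: "t = s @ [x]"
      by (cases t rule: rev_cases) (auto simp: distinct_tails_def)
    have len: "length s = k" and bound: "\<And>i. i < Suc k \<Longrightarrow> t ! i \<le> m + i"
      using t by (auto simp: distinct_tails_def tx)
    have "s ! i \<le> m + i" if "i < k" for i
      using bound[of i] that len by (simp add: tx nth_append)
    moreover have "x \<le> m + k"
      using bound[of k] len by (simp add: tx nth_append)
    ultimately have "(s, x) \<in> (SIGMA s:distinct_tails m k. {1..m + k} - set s)"
      using t len by (auto simp: distinct_tails_def tx Suc_le_eq)
    then show "t \<in> ?B"
      unfolding tx by force
  qed
  show "?B \<subseteq> ?A"
    by (auto simp: distinct_tails_def nth_append less_Suc_eq)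
qed

text \<open>Appending a letter at index \<open>k\<close> leaves \<open>(m + k) - k = m\<close> choices: the \<open>k\<close> letters present are
  distinct and all lie in \<open>{1..m + k}\<close>, because the upper bounds increase along the word.\<close>

lemma card_distinct_tails: "finite (distinct_tails m k) \<and> card (distinct_tails m k) = m ^ k"
proof (induction k)
  case 0
  have "distinct_tails m 0 = {[]}"
    by (auto simp: distinct_tails_def)
  then show ?case by simp
next
  case (Suc k)
  have choices: "card ({1..m + k} - set s) = m" if s: "s \<in> distinct_tails m k" for s
  proof -
    have len: "length s = k" and nonzero: "0 \<notin> set s" and bound: "\<forall>i<k. s ! i \<le> m + i"
      using s by (simp_all add: distinct_tails_def)
    have "set s \<subseteq> {1..m + k}"
    proof
      fix x assume x: "x \<in> set s"
      then obtain i where i: "i < k" "x = s ! i"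
        using len by (metis in_set_conv_nth)
      have "x \<noteq> 0"
        using x nonzero by metis
      moreover have "x \<le> m + i"
        using i bound by simp
      ultimately show "x \<in> {1..m + k}"
        using i(1) by simp
    qed
    moreover have "card (set s) = k"
      using s by (auto simp: distinct_tails_def distinct_card)
    ultimately show ?thesis
      by (simp add: card_Diff_subset)
  qed
  have "inj_on (\<lambda>(s, x). s @ [x]) (SIGMA s:distinct_tails m k. {1..m + k} - set s)"
    by (auto simp: inj_on_def)
  then have "card (distinct_tails m (Suc k)) = (\<Sum>s\<in>distinct_tails m k. card ({1..m + k} - set s))"
    unfolding distinct_tails_Suc using Suc.IH by (simp add: card_image card_SigmaI)
  also have "\<dots> = m ^ Suc k"
    using Suc.IH choices by simp
  finally show ?case
    using Suc.IH by (simp add: distinct_tails_Suc)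
qed

theorem theorem2p16:
  fixes n :: nat
  assumes "n \<ge> 1"
  shows "card (avoiding_inversion_sequences n [0, 1, 0] [0, 1, 1])
           = (\<Sum>k = 0..n - 1. (n - k) ^ k)"
proof -
  define W where "W m = (\<lambda>s. replicate m 0 @ s) ` distinct_tails m (n - m)" for m
  have union: "avoiding_inversion_sequences n [0, 1, 0] [0, 1, 1] = (\<Union>m\<in>{1..n}. W m)"
    using avoiding_inversion_sequences_010_011_iff[OF assms] unfolding W_def by blast
  have card_W: "finite (W m) \<and> card (W m) = m ^ (n - m)" for m
    unfolding W_def using card_distinct_tails by (simp add: card_image inj_on_def)
  \<comment> \<open>A tail contains no \<open>0\<close>, so the number of zeros determines \<open>m\<close>.\<close>
  have zeros: "length (filter (\<lambda>x. x = 0) e) = m" if e: "e \<in> W m" for e m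
  proof -
    obtain s where "e = replicate m 0 @ s" "0 \<notin> set s"
      using e unfolding W_def distinct_tails_def by blast
    then show ?thesis
      by (simp add: filter_empty_conv) (metis gr0I)
  qed
  have "W i \<inter> W j = {}" if "i \<noteq> j" for i j
    using zeros that by blast
  then have "card (\<Union>m\<in>{1..n}. W m) = (\<Sum>m\<in>{1..n}. m ^ (n - m))"
    using card_W by (subst card_UN_disjoint) auto
  also have "\<dots> = (\<Sum>k = 0..n - 1. (n - k) ^ k)"
    using assms
    by (intro sum.reindex_bij_witness[where i = "\<lambda>k. n - k" and j = "\<lambda>m. n - m"]) auto
  finally show ?thesis
    unfolding union .
qed

end
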